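(* Let $R=\Bbbk[z][x,y;\sigma,a]$ be a classical generalized Weyl algebra with $\sigma(z)=z-1$, where $a\in\Bbbk[z]$ is monic with $0$ as a root, and let $n=\deg_z(a)$. Suppose that $a$ is reflective, so there exists $\rho\in\Bbbk$ with $a(\rho-z)=(-1)^na(z)$. Let $\beta\in\Bbbk^\times$. If $n$ is even, then the fixed ring $R^{\langle\Theta_\beta\circ\Omega\rangle}$ is generated over $\Bbbk[z(1+\rho-z)]$ by $x+\beta^{-1}y$ and $zx+\beta^{-1}(1+\rho-z)y$. If $n$ is odd, then $R^{\langle\Theta_\beta\circ\Omega\rangle}$ is generated over $\Bbbk[z(1+\rho-z)]$ by $x^2+\beta^{-2}y^2$ and $zx^2+\beta^{-2}(1+\rho-z)y^2$.
   Context: $\Bbbk$ is an algebraically closed field of characteristic zero; all algebras are $\Bbbk$-algebras. Classical GWA: $R=\Bbbk[z][x,y;\sigma,a]$, with $\sigma(z)=z-1$, is the ring obtained by adjoining to $\Bbbk[z]$ the variables $x,y$ subject to $xy=\sigma(a)$, $yx=a$, $xd=\sigma(d)x$, $yd=\sigma^{-1}(d)y$ for all $d\in\Bbbk[z]$. Maps: $\Theta_\beta$ is the automorphism $x\mapsto\beta x$, $y\mapsto\beta^{-1}y$, $z\mapsto z$; $\Omega$ is the automorphism $x\mapsto y$, $y\mapsto(-1)^nx$, $z\mapsto1+\rho-z$. Composition is right-to-left: $(\phi\circ\psi)(r)=\phi(\psi(r))$. "Generated over $\Bbbk[z(1+\rho-z)]$" means generated as a ring by the commutative subalgebra $\Bbbk[z(1+\rho-z)]\subset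 R$ together with the listed elements. $R^{\langle g\rangle}$ is the ring of elements fixed by $g$. *)

theory Defs
  imports
    "HOL-Algebra.QuotRing"
    "HOL-Algebra.Generated_Rings"
    "HOL-Library.Poly_Mapping"
    "HOL-Computational_Algebra.Polynomial"
begin

section \<open>Free associative algebras\<close>

text \<open>
  The type of lists is not an additive monoid in the library, so words are wrapped in order to
  obtain the free algebra as the monoid algebra \<open>'g word \<Rightarrow>\<^sub>0 'k\<close>, with
  the (noncommutative) convolution product of \<^theory>\<open>HOL-Library.Poly_Mapping\<close>.
\<close>

datatype 'g word = Word (letters: "'g list")

instantiation word :: (type) monoid_add
begin

definition zero_word :: "'a word" where "0 = Word []"

definition plus_word :: "'a word \<Rightarrow> 'a word \<Rightarrow> 'a word"
  where "u + v = Word (letters u @ letters v)"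

instance
  by standard (simp_all add: zero_word_def plus_word_def)

end

datatype gen = Gz | Gx | Gy

type_synonym 'k falg = "gen word \<Rightarrow>\<^sub>0 'k"

definition scal :: "'k::comm_ring_1 \<Rightarrow> 'k falg"
  where "scal c = Poly_Mapping.single 0 c"

definition var :: "gen \<Rightarrow> 'k::comm_ring_1 falg"
  where "var g = Poly_Mapping.single (Word [g]) 1"

definition free_alg :: "'k::comm_ring_1 falg ring"
  where "free_alg = \<lparr>carrier = UNIV, monoid.mult = (*), one = 1, zero = 0, add = (+)\<rparr>"

text \<open>The \<open>'k\<close>-algebra endomorphism of the free algebra sending each generator \<open>g\<close> to \<open>s g\<close>.\<close>

definition subst :: "(gen \<Rightarrow> 'k::comm_ring_1 falg) \<Rightarrow> 'k falg \<Rightarrow> 'k falg"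
  where "subst s p = (\<Sum>w\<in>Poly_Mapping.keys p.
           scal (Poly_Mapping.lookup p w) * prod_list (map s (letters w)))"

text \<open>The copy of \<open>'k[z]\<close> inside the free algebra.\<close>

definition zpoly :: "'k::comm_ring_1 poly \<Rightarrow> 'k falg"
  where "zpoly d = (\<Sum>i\<le>degree d. scal (Polynomial.coeff d i) * var Gz ^ i)"


section \<open>Generalized Weyl algebras over \<open>'k[z]\<close>\<close>

text \<open>
  Adjoining \<open>x, y\<close> to \<open>'k[z]\<close> as a \<open>'k\<close>-algebra means passing to the free algebra on
  \<open>z, x, y\<close>; the defining relations are then imposed by a quotient by a two-sided ideal.
\<close>

definition gwa_rels :: "('k::comm_ring_1 poly \<Rightarrow> 'k poly) \<Rightarrow> 'k poly \<Rightarrow> 'k falg set"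
  where "gwa_rels \<sigma> a =
    {var Gx * var Gy - zpoly (\<sigma> a), var Gy * var Gx - zpoly a}
    \<union> range (\<lambda>d. var Gx * zpoly d - zpoly (\<sigma> d) * var Gx)
    \<union> range (\<lambda>d. var Gy * zpoly d - zpoly (inv_into UNIV \<sigma> d) * var Gy)"

definition gwa_ideal :: "('k::comm_ring_1 poly \<Rightarrow> 'k poly) \<Rightarrow> 'k poly \<Rightarrow> 'k falg set"
  where "gwa_ideal \<sigma> a = genideal free_alg (gwa_rels \<sigma> a)"

definition gwa :: "('k::comm_ring_1 poly \<Rightarrow> 'k poly) \<Rightarrow> 'k poly \<Rightarrow> 'k falg set ring"
  where "gwa \<sigma> a = free_alg Quot (gwa_ideal \<sigma> a)"

definition gwa_cls :: "('k::comm_ring_1 poly \<Rightarrow> 'k poly) \<Rightarrow> 'k poly \<Rightarrow> 'k falg \<Rightarrow> 'k falg set"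
  where "gwa_cls \<sigma> a p = gwa_ideal \<sigma> a +>\<^bsub>free_alg\<^esub> p"

text \<open>
  The endomorphism of the generalized Weyl algebra induced by a substitution of the generators.
  It is meaningful only if the substitution maps the defining ideal into itself; for the two
  substitutions below this is established at the end of this theory.
\<close>

definition gwa_map ::
    "('k::comm_ring_1 poly \<Rightarrow> 'k poly) \<Rightarrow> 'k poly \<Rightarrow> (gen \<Rightarrow> 'k falg) \<Rightarrow> 'k falg set \<Rightarrow> 'k falg set"
  where "gwa_map \<sigma> a s = (\<lambda>C. the_elem ((\<lambda>p. gwa_cls \<sigma> a (subst s p)) ` C))"

definition fixed_elems :: "('r, 'm) ring_scheme \<Rightarrow> ('r \<Rightarrow> 'r) \<Rightarrow> 'r set"
  where "fixed_elems R f = {r \<in> carrier R. f r = r}"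


subsection \<open>The classical case\<close>

definition shift :: "'k::comm_ring_1 poly \<Rightarrow> 'k poly"
  where "shift d = pcompose d [:-1, 1:]"

abbreviation cgwa :: "'k::comm_ring_1 poly \<Rightarrow> 'k falg set ring"
  where "cgwa a \<equiv> gwa shift a"

abbreviation cgwa_cls :: "'k::comm_ring_1 poly \<Rightarrow> 'k falg \<Rightarrow> 'k falg set"
  where "cgwa_cls a \<equiv> gwa_cls shift a"

fun Theta_gen :: "'k::field \<Rightarrow> gen \<Rightarrow> 'k falg" where
  "Theta_gen \<beta> Gz = var Gz"
| "Theta_gen \<beta> Gx = scal \<beta> * var Gx"
| "Theta_gen \<beta> Gy = scal (inverse \<beta>) * var Gy"

fun Omega_gen :: "nat \<Rightarrow> 'k::comm_ring_1 \<Rightarrow> gen \<Rightarrow> 'k falg" where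
  "Omega_gen n \<rho> Gz = scal (1 + \<rho>) - var Gz"
| "Omega_gen n \<rho> Gx = var Gy"
| "Omega_gen n \<rho> Gy = scal ((-1) ^ n) * var Gx"

definition Theta :: "'k::field poly \<Rightarrow> 'k \<Rightarrow> 'k falg set \<Rightarrow> 'k falg set"
  where "Theta a \<beta> = gwa_map shift a (Theta_gen \<beta>)"

definition Omega :: "'k::comm_ring_1 poly \<Rightarrow> 'k \<Rightarrow> 'k falg set \<Rightarrow> 'k falg set"
  where "Omega a \<rho> = gwa_map shift a (Omega_gen (degree a) \<rho>)"

text \<open>The commutative subalgebra \<open>'k[z(1 + \<rho> - z)]\<close>.\<close>

definition sym_subalg :: "'k::comm_ring_1 poly \<Rightarrow> 'k \<Rightarrow> 'k falg set set"
  where "sym_subalg a \<rho> =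
    range (\<lambda>d. cgwa_cls a (zpoly (pcompose d ([:0, 1:] * [:1 + \<rho>, -1:]))))"


subsection \<open>\<open>Theta\<close> and \<open>Omega\<close> are the expected algebra automorphisms\<close>

lemma free_alg_simps [simp]:
  "carrier free_alg = UNIV" "monoid.mult free_alg = (*)" "one free_alg = 1"
  "zero free_alg = 0" "add free_alg = (+)"
  by (simp_all add: free_alg_def)

lemma ring_free_alg: "ring (free_alg :: 'k::comm_ring_1 falg ring)"
proof (rule ringI)
  show "abelian_group (free_alg :: 'k falg ring)"
  proof (rule abelian_groupI)
    fix x :: "'k falg"
    show "\<exists>y\<in>carrier free_alg. y \<oplus>\<^bsub>free_alg\<^esub> x = \<zero>\<^bsub>free_alg\<^esub>"
      by (rule bexI[of _ "- x"]) simp_all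
  qed (simp_all add: algebra_simps)
  show "Group.monoid (free_alg :: 'k falg ring)"
    by (rule monoidI) (simp_all add: algebra_simps)
qed (simp_all add: algebra_simps)

lemma ideal_gwa_ideal: "ideal (gwa_ideal \<sigma> a) free_alg"
  unfolding gwa_ideal_def by (rule ring.genideal_ideal[OF ring_free_alg]) simp

lemma ring_gwa: "ring (gwa \<sigma> a)"
  unfolding gwa_def by (rule ideal.quotient_is_ring[OF ideal_gwa_ideal])

lemma gwa_cls_hom: "gwa_cls \<sigma> a \<in> ring_hom free_alg (gwa \<sigma> a)"
  unfolding gwa_def gwa_cls_def[abs_def] by (rule ideal.rcos_ring_hom[OF ideal_gwa_ideal])

lemma carrier_gwa: "carrier (gwa \<sigma> a) = range (gwa_cls \<sigma> a)"
  by (auto simp: gwa_def FactRing_def A_RCOSETS_def' gwa_cls_def)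

lemma gwa_cls_simps:
  "gwa_cls \<sigma> a (p + q) = gwa_cls \<sigma> a p \<oplus>\<^bsub>gwa \<sigma> a\<^esub> gwa_cls \<sigma> a q"
  "gwa_cls \<sigma> a (p * q) = gwa_cls \<sigma> a p \<otimes>\<^bsub>gwa \<sigma> a\<^esub> gwa_cls \<sigma> a q"
  "gwa_cls \<sigma> a 1 = \<one>\<^bsub>gwa \<sigma> a\<^esub>"
  using ring_hom_add[OF gwa_cls_hom, of p q \<sigma> a] ring_hom_mult[OF gwa_cls_hom, of p q \<sigma> a]
    ring_hom_one[OF gwa_cls_hom, of \<sigma> a] by simp_all

lemma gwa_ideal_0: "0 \<in> gwa_ideal \<sigma> a"
  using additive_subgroup.zero_closed[OF ideal.axioms(1)[OF ideal_gwa_ideal[of \<sigma> a]]] by simp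

lemma gwa_ideal_add: "p \<in> gwa_ideal \<sigma> a \<Longrightarrow> q \<in> gwa_ideal \<sigma> a \<Longrightarrow> p + q \<in> gwa_ideal \<sigma> a"
  using additive_subgroup.a_closed[OF ideal.axioms(1)[OF ideal_gwa_ideal[of \<sigma> a]]] by simp

lemma gwa_ideal_mult:
  "p \<in> gwa_ideal \<sigma> a \<Longrightarrow> q * p \<in> gwa_ideal \<sigma> a"
  "p \<in> gwa_ideal \<sigma> a \<Longrightarrow> p * q \<in> gwa_ideal \<sigma> a"
  using ideal.I_l_closed[OF ideal_gwa_ideal, of p \<sigma> a q] ideal.I_r_closed[OF ideal_gwa_ideal, of p \<sigma> a q]
  by simp_all

lemma gwa_ideal_uminus: "p \<in> gwa_ideal \<sigma> a \<Longrightarrow> - p \<in> gwa_ideal \<sigma> a"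
  using gwa_ideal_mult(1)[of p \<sigma> a "-1"] by simp

lemma gwa_ideal_rels: "p \<in> gwa_rels \<sigma> a \<Longrightarrow> p \<in> gwa_ideal \<sigma> a"
  using ring.genideal_self[OF ring_free_alg, of "gwa_rels \<sigma> a"] by (auto simp: gwa_ideal_def)

lemma gwa_cls_alt: "gwa_cls \<sigma> a p = (\<lambda>i. i + p) ` gwa_ideal \<sigma> a"
  by (auto simp: gwa_cls_def a_r_coset_def r_coset_def)

lemma gwa_cls_eq_iff: "gwa_cls \<sigma> a p = gwa_cls \<sigma> a q \<longleftrightarrow> p - q \<in> gwa_ideal \<sigma> a"
proof
  assume "gwa_cls \<sigma> a p = gwa_cls \<sigma> a q"
  moreover have "p \<in> gwa_cls \<sigma> a p"
    unfolding gwa_cls_alt using gwa_ideal_0[of \<sigma> a] by force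
  ultimately show "p - q \<in> gwa_ideal \<sigma> a" by (auto simp: gwa_cls_alt)
next
  have *: "gwa_cls \<sigma> a p \<subseteq> gwa_cls \<sigma> a q" if "p - q \<in> gwa_ideal \<sigma> a" for p q
  proof
    fix r assume "r \<in> gwa_cls \<sigma> a p"
    then obtain i where i: "i \<in> gwa_ideal \<sigma> a" "r = i + p" by (auto simp: gwa_cls_alt)
    have "r = (i + (p - q)) + q" using i by simp
    with gwa_ideal_add[OF i(1) that] show "r \<in> gwa_cls \<sigma> a q" unfolding gwa_cls_alt by blast
  qed
  assume "p - q \<in> gwa_ideal \<sigma> a"
  with *[of p q] *[of q p] gwa_ideal_uminus[of "p - q" \<sigma> a] show "gwa_cls \<sigma> a p = gwa_cls \<sigma> a q"
    by (simp add: subset_antisym)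
qed

lemma falg_induct:
  fixes p :: "'k::comm_ring_1 falg"
  assumes "P 0" "\<And>w c. P (Poly_Mapping.single w c)" "\<And>p q. P p \<Longrightarrow> P q \<Longrightarrow> P (p + q)"
  shows "P p"
proof (induction p rule: update_induct)
  case const
  then show ?case by (rule assms(1))
next
  case (update p w c)
  have "Poly_Mapping.update w c p = p + Poly_Mapping.single w c"
    using update(1) by (intro poly_mapping_eqI) (auto simp: lookup_update lookup_add lookup_single in_keys_iff)
  with update assms show ?case by simp
qed

lemma scal_simps:
  "scal (c + d) = scal c + scal d" "scal (c * d) = scal c * scal d" "scal 0 = 0" "scal 1 = 1"
  "scal (c - d) = scal c - scal d" "scal (- c) = - scal c"
  by (simp_all add: scal_def single_add mult_single single_diff single_uminus)

lemma scal_comm: "scal c * p = p * scal c"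
  by (induction p rule: falg_induct)
    (simp_all add: scal_def mult_single mult.commute distrib_left distrib_right)

lemma subst_superset:
  assumes "finite A" "Poly_Mapping.keys p \<subseteq> A"
  shows "subst s p = (\<Sum>w\<in>A. scal (Poly_Mapping.lookup p w) * prod_list (map s (letters w)))"
  unfolding subst_def using assms
  by (intro sum.mono_neutral_left) (auto simp: in_keys_iff scal_simps)

lemma subst_add: "subst s (p + q) = subst s p + subst s q"
proof -
  let ?A = "Poly_Mapping.keys p \<union> Poly_Mapping.keys q"
  have "subst s (p + q) = (\<Sum>w\<in>?A. scal (Poly_Mapping.lookup (p + q) w) * prod_list (map s (letters w)))"
    by (rule subst_superset) (use keys_add[of p q] in auto)
  also have "\<dots> = (\<Sum>w\<in>?A. scal (Poly_Mapping.lookup p w) * prod_list (map s (letters w)))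
      + (\<Sum>w\<in>?A. scal (Poly_Mapping.lookup q w) * prod_list (map s (letters w)))"
    by (simp add: lookup_add scal_simps distrib_right sum.distrib)
  also have "\<dots> = subst s p + subst s q"
    by (simp add: subst_superset[of ?A])
  finally show ?thesis .
qed

lemma subst_single: "subst s (Poly_Mapping.single w c) = scal c * prod_list (map s (letters w))"
  by (subst subst_superset[of "{w}"]) auto

lemma subst_0: "subst s 0 = 0"
  by (simp add: subst_def)

lemma subst_scal: "subst s (scal c) = scal c"
  by (simp add: scal_def[of c] subst_single) (simp add: zero_word_def scal_def)

lemma subst_1: "subst s 1 = 1"
  using subst_scal[of s 1] by (simp add: scal_simps)

lemma subst_var: "subst s (var g) = s g"
  by (simp add: var_def subst_single scal_simps)

lemma subst_mult: "subst s (p * q) = subst s p * subst s q"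
proof (induction p rule: falg_induct)
  case (2 w c)
  show ?case
  proof (induction q rule: falg_induct)
    case (2 v d)
    let ?P = "\<lambda>w. prod_list (map s (letters w))"
    have "subst s (Poly_Mapping.single w c * Poly_Mapping.single v d)
        = scal c * (scal d * ?P w) * ?P v"
      by (simp add: mult_single subst_single plus_word_def scal_simps mult.assoc)
    also have "\<dots> = scal c * ?P w * (scal d * ?P v)"
      by (simp only: scal_comm[of d "?P w"] mult.assoc)
    finally show ?case by (simp add: subst_single)
  qed (simp_all add: subst_0 subst_add distrib_left)
qed (simp_all add: subst_0 subst_add distrib_right)

lemma subst_uminus: "subst s (- p) = - subst s p"
  using subst_add[of s p "- p"] by (simp add: subst_0 minus_unique)

lemma subst_diff: "subst s (p - q) = subst s p - subst s q"
  using subst_add[of s p "- q"] by (simp add: subst_uminus)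

lemmas subst_simps = subst_add subst_0 subst_scal subst_1 subst_var subst_mult subst_uminus subst_diff

lemma zpoly_0: "zpoly 0 = 0"
  by (simp add: zpoly_def scal_simps)

lemma zpoly_pCons: "zpoly (pCons c p) = scal c + var Gz * zpoly p"
proof (cases "p = 0")
  case True
  then show ?thesis by (simp add: zpoly_def scal_simps)
next
  case False
  have "zpoly (pCons c p) = (\<Sum>i\<le>Suc (degree p). scal (Polynomial.coeff (pCons c p) i) * var Gz ^ i)"
    using False by (simp add: zpoly_def)
  also have "\<dots> = scal c + (\<Sum>i\<le>degree p. scal (Polynomial.coeff p i) * (var Gz * var Gz ^ i))"
    by (subst sum.atMost_Suc_shift) simp
  also have "(\<Sum>i\<le>degree p. scal (Polynomial.coeff p i) * (var Gz * var Gz ^ i)) = var Gz * zpoly p"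
    unfolding zpoly_def sum_distrib_left
    by (intro sum.cong refl) (metis mult.assoc scal_comm)
  finally show ?thesis .
qed

lemma zpoly_add: "zpoly (p + q) = zpoly p + zpoly q"
  by (induction p q rule: poly_induct2)
    (simp_all add: zpoly_0 zpoly_pCons scal_simps algebra_simps)

lemma zpoly_smult: "zpoly (smult c p) = scal c * zpoly p"
  by (induction p) (simp_all add: zpoly_0 zpoly_pCons scal_simps distrib_left,
    metis mult.assoc scal_comm)

lemma zpoly_mult: "zpoly (p * q) = zpoly p * zpoly q"
  by (induction p)
    (simp_all add: zpoly_0 zpoly_pCons zpoly_add zpoly_smult scal_simps distrib_right mult.assoc)

lemma subst_zpoly:
  assumes "s Gz = zpoly e"
  shows "subst s (zpoly d) = zpoly (pcompose d e)"
  by (induction d)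
    (simp_all add: zpoly_0 zpoly_pCons subst_simps assms pcompose_pCons zpoly_add zpoly_mult scal_simps)

lemma inv_shift: "inv_into UNIV shift d = pcompose d [:1, 1 :: 'k::comm_ring_1:]"
proof -
  have "shift (pcompose d [:1, 1:]) = d" for d :: "'k poly"
    by (simp add: shift_def flip: pcompose_assoc) (simp add: pcompose_pCons pcompose_idR)
  moreover have "pcompose (shift d) [:1, 1:] = d" for d :: "'k poly"
    by (simp add: shift_def flip: pcompose_assoc) (simp add: pcompose_pCons pcompose_idR)
  ultimately show ?thesis
    by (metis (no_types, lifting) inj_onI inv_f_f)
qed

lemma gwa_ideal_subst:
  assumes rels: "\<And>p. p \<in> gwa_rels \<sigma> a \<Longrightarrow> subst s p \<in> gwa_ideal \<sigma> a"
    and p: "p \<in> gwa_ideal \<sigma> a"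
  shows "subst s p \<in> gwa_ideal \<sigma> a"
proof -
  let ?J = "{p. subst s p \<in> gwa_ideal \<sigma> a}"
  have "ideal ?J free_alg"
  proof (rule idealI[OF ring_free_alg])
    show "subgroup ?J (add_monoid (free_alg :: 'a falg ring))"
    proof
      fix x assume x: "x \<in> ?J"
      have "inv\<^bsub>add_monoid free_alg\<^esub> x = - x"
        by (rule group.inv_equality[OF abelian_group.a_group[OF ring.is_abelian_group[OF ring_free_alg]]])
          simp_all
      with x show "inv\<^bsub>add_monoid free_alg\<^esub> x \<in> ?J"
        by (simp add: subst_simps gwa_ideal_uminus)
    qed (simp_all add: subst_simps gwa_ideal_0 gwa_ideal_add)
  qed (simp_all add: subst_simps gwa_ideal_mult)
  then have "gwa_ideal \<sigma> a \<subseteq> ?J"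
    unfolding gwa_ideal_def[of \<sigma> a]
    by (rule ring.genideal_minimal[OF ring_free_alg]) (use rels in \<open>auto simp: gwa_ideal_def\<close>)
  with p show ?thesis by blast
qed

lemma gwa_map_cls:
  assumes "\<And>p. p \<in> gwa_rels \<sigma> a \<Longrightarrow> subst s p \<in> gwa_ideal \<sigma> a"
  shows "gwa_map \<sigma> a s (gwa_cls \<sigma> a p) = gwa_cls \<sigma> a (subst s p)"
proof -
  have "(\<lambda>q. gwa_cls \<sigma> a (subst s q)) ` gwa_cls \<sigma> a p = {gwa_cls \<sigma> a (subst s p)}"
  proof -
    have "gwa_cls \<sigma> a (subst s (i + p)) = gwa_cls \<sigma> a (subst s p)" if "i \<in> gwa_ideal \<sigma> a" for i
      using gwa_ideal_subst[OF assms that] by (simp add: gwa_cls_eq_iff subst_simps)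
    then show ?thesis
      using gwa_ideal_0[of \<sigma> a] by (auto simp: gwa_cls_alt[of \<sigma> a p] image_image)
  qed
  then show ?thesis by (simp add: gwa_map_def)
qed

lemma gwa_map_hom:
  assumes "\<And>p. p \<in> gwa_rels \<sigma> a \<Longrightarrow> subst s p \<in> gwa_ideal \<sigma> a"
  shows "gwa_map \<sigma> a s \<in> ring_hom (gwa \<sigma> a) (gwa \<sigma> a)"
  by (rule ring_hom_memI)
    (auto simp: carrier_gwa gwa_map_cls[OF assms] subst_simps simp flip: gwa_cls_simps)

lemma zpoly_affine: "zpoly [:c, -1:] = scal c - var Gz" "zpoly [:0, 1:] = var Gz"
  by (simp_all add: zpoly_pCons zpoly_0 scal_simps)

lemma scal_mult_scal: "scal c * u * (scal d * v) = scal (c * d) * (u * v)"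
  by (metis mult.assoc scal_comm scal_simps(2))

lemma gwa_rels_cases [consumes 1, case_names xy yx x y]:
  assumes "p \<in> gwa_rels \<sigma> a"
  obtains "p = var Gx * var Gy - zpoly (\<sigma> a)" | "p = var Gy * var Gx - zpoly a"
    | d where "p = var Gx * zpoly d - zpoly (\<sigma> d) * var Gx"
    | d where "p = var Gy * zpoly d - zpoly (inv_into UNIV \<sigma> d) * var Gy"
  using assms by (auto simp: gwa_rels_def)

lemma gwa_rels_mem:
  "var Gx * var Gy - zpoly (\<sigma> a) \<in> gwa_ideal \<sigma> a"
  "var Gy * var Gx - zpoly a \<in> gwa_ideal \<sigma> a"
  "var Gx * zpoly d - zpoly (\<sigma> d) * var Gx \<in> gwa_ideal \<sigma> a"
  "var Gy * zpoly d - zpoly (inv_into UNIV \<sigma> d) * var Gy \<in> gwa_ideal \<sigma> a"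
  by (rule gwa_ideal_rels, simp add: gwa_rels_def)+

lemma subst_commutator:
  assumes "u * zpoly d - w * u \<in> gwa_ideal \<sigma> a"
  shows "scal c * u * zpoly d - w * (scal c * u) \<in> gwa_ideal \<sigma> a"
proof -
  have "scal c * u * zpoly d - w * (scal c * u) = scal c * (u * zpoly d - w * u)"
    by (simp add: right_diff_distrib mult.assoc) (metis mult.assoc scal_comm)
  then show ?thesis by (simp add: gwa_ideal_mult assms)
qed

lemma Theta_rels:
  assumes "\<beta> \<noteq> 0" "p \<in> gwa_rels shift a"
  shows "subst (Theta_gen \<beta>) p \<in> gwa_ideal shift a"
proof -
  have z: "subst (Theta_gen \<beta>) (zpoly d) = zpoly d" for d
    using subst_zpoly[of "Theta_gen \<beta>" "[:0, 1:]" d] by (simp add: zpoly_affine pcompose_idR)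
  from assms(2) show ?thesis
    by (cases rule: gwa_rels_cases)
      (use assms(1) in \<open>simp_all add: subst_simps z scal_mult_scal scal_simps
         gwa_rels_mem subst_commutator\<close>)
qed

lemma Omega_rels:
  assumes refl: "pcompose a [:\<rho>, -1:] = (-1) ^ n * a" and "p \<in> gwa_rels shift a"
  shows "subst (Omega_gen n \<rho>) p \<in> gwa_ideal shift a"
proof -
  let ?e = "[:1 + \<rho>, -1:]" and ?c = "(-1) ^ n :: 'a"
  have z: "subst (Omega_gen n \<rho>) (zpoly d) = zpoly (pcompose d ?e)" for d
    using subst_zpoly[of "Omega_gen n \<rho>" ?e d] by (simp add: zpoly_affine)
  have c: "(-1) ^ n * d = smult ?c d" for d
    by (cases "even n") simp_all
  have sh: "pcompose (shift d) ?e = pcompose d [:\<rho>, -1:]"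
    "pcompose (inv_into UNIV shift d) ?e = shift (pcompose d ?e)"
    "pcompose (shift d) ?e = inv_into UNIV shift (pcompose d ?e)" for d
    unfolding inv_shift unfolding shift_def
    by (simp_all add: pcompose_pCons algebra_simps flip: pcompose_assoc)
  have a1: "pcompose (shift a) ?e = smult ?c a"
    using sh(1)[of a] refl c by simp
  have "pcompose a ?e = shift (pcompose a [:\<rho>, -1:])"
    unfolding shift_def by (simp add: pcompose_pCons algebra_simps flip: pcompose_assoc)
  then have a2: "pcompose a ?e = smult ?c (shift a)"
    by (simp add: refl c shift_def pcompose_smult)
  from assms(2) show ?thesis
  proof (cases rule: gwa_rels_cases)
    case xy
    have "subst (Omega_gen n \<rho>) p = scal ?c * (var Gy * var Gx - zpoly a)"
      by (simp add: xy subst_simps z a1 zpoly_smult right_diff_distrib) (metis mult.assoc scal_comm)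
    then show ?thesis by (simp add: gwa_ideal_mult gwa_rels_mem)
  next
    case yx
    have "subst (Omega_gen n \<rho>) p = scal ?c * (var Gx * var Gy - zpoly (shift a))"
      by (simp add: yx subst_simps z a2 zpoly_smult right_diff_distrib mult.assoc)
    then show ?thesis by (simp add: gwa_ideal_mult gwa_rels_mem)
  next
    case (x d)
    then show ?thesis by (simp add: subst_simps z sh(3) gwa_rels_mem)
  next
    case (y d)
    then show ?thesis by (simp add: subst_simps z sh(2) gwa_rels_mem subst_commutator)
  qed
qed

lemma subst_subst: "subst s (subst t p) = subst (\<lambda>g. subst s (t g)) p"
proof (induction p rule: falg_induct)
  case (2 w c)
  have "subst s (prod_list (map t gs)) = prod_list (map (\<lambda>g. subst s (t g)) gs)" for gs
    by (induction gs) (simp_all add: subst_simps)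
  then show ?case by (simp add: subst_single subst_simps)
qed (simp_all add: subst_simps)

lemma subst_id:
  fixes p :: "'k::comm_ring_1 falg"
  shows "subst var p = p"
proof (induction p rule: falg_induct)
  case (2 w c)
  have "prod_list (map var gs) = Poly_Mapping.single (Word gs) (1 :: 'k)" for gs
    by (induction gs) (simp_all add: var_def mult_single plus_word_def flip: single_one zero_word_def)
  then show ?case by (simp add: subst_single scal_def mult_single)
qed (simp_all add: subst_simps)

lemma gwa_map_iso:
  assumes "\<And>p. p \<in> gwa_rels \<sigma> a \<Longrightarrow> subst s p \<in> gwa_ideal \<sigma> a"
    and "\<And>p. p \<in> gwa_rels \<sigma> a \<Longrightarrow> subst t p \<in> gwa_ideal \<sigma> a"
    and "\<And>g. subst s (t g) = var g" "\<And>g. subst t (s g) = var g"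
  shows "gwa_map \<sigma> a s \<in> ring_iso (gwa \<sigma> a) (gwa \<sigma> a)"
proof -
  have inv: "subst s (subst t p) = p" "subst t (subst s p) = p" for p
    by (simp_all add: subst_subst assms(3,4) subst_id)
  have "bij_betw (gwa_map \<sigma> a s) (carrier (gwa \<sigma> a)) (carrier (gwa \<sigma> a))"
    by (rule bij_betw_byWitness[where f' = "gwa_map \<sigma> a t"])
      (auto simp: carrier_gwa gwa_map_cls assms(1,2) inv)
  with gwa_map_hom[OF assms(1)] show ?thesis by (simp add: ring_iso_def)
qed

theorem Theta_automorphism:
  assumes "\<beta> \<noteq> 0"
  shows "Theta a \<beta> \<in> ring_iso (cgwa a) (cgwa a)"
    and "Theta a \<beta> (cgwa_cls a (scal c)) = cgwa_cls a (scal c)"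
    and "Theta a \<beta> (cgwa_cls a (var Gx)) = cgwa_cls a (scal \<beta> * var Gx)"
    and "Theta a \<beta> (cgwa_cls a (var Gy)) = cgwa_cls a (scal (inverse \<beta>) * var Gy)"
    and "Theta a \<beta> (cgwa_cls a (var Gz)) = cgwa_cls a (var Gz)"
proof -
  have inv: "subst (Theta_gen \<gamma>) (Theta_gen (inverse \<gamma>) g) = var g" if "\<gamma> \<noteq> 0" for \<gamma> :: 'a and g
    using that by (cases g) (simp_all add: subst_simps scal_simps flip: mult.assoc scal_simps(2))
  show "Theta a \<beta> \<in> ring_iso (cgwa a) (cgwa a)"
    unfolding Theta_def
    by (rule gwa_map_iso[where t = "Theta_gen (inverse \<beta>)"])
      (use assms inv[of \<beta>] inv[of "inverse \<beta>"] in \<open>simp_all add: Theta_rels\<close>)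
qed (simp_all add: Theta_def gwa_map_cls Theta_rels assms subst_simps)

theorem Omega_automorphism:
  assumes "pcompose a [:\<rho>, -1:] = (-1) ^ degree a * a"
  shows "Omega a \<rho> \<in> ring_iso (cgwa a) (cgwa a)"
    and "Omega a \<rho> (cgwa_cls a (scal c)) = cgwa_cls a (scal c)"
    and "Omega a \<rho> (cgwa_cls a (var Gx)) = cgwa_cls a (var Gy)"
    and "Omega a \<rho> (cgwa_cls a (var Gy)) = cgwa_cls a (scal ((-1) ^ degree a) * var Gx)"
    and "Omega a \<rho> (cgwa_cls a (var Gz)) = cgwa_cls a (scal (1 + \<rho>) - var Gz)"
proof -
  let ?c = "(-1) ^ degree a :: 'a" and ?O = "Omega_gen (degree a) \<rho>"
  let ?N = "\<lambda>g. case g of Gz \<Rightarrow> var Gz | _ \<Rightarrow> scal ?c * var g"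
  let ?t = "\<lambda>g. subst ?O (?N g)"
  have c: "scal ?c * (scal ?c * u) = u" for u
    by (cases "even (degree a)") (simp_all add: scal_simps)
  have N: "subst ?N p \<in> gwa_ideal shift a" if "p \<in> gwa_rels shift a" for p
  proof -
    have z: "subst ?N (zpoly d) = zpoly d" for d
      using subst_zpoly[of ?N "[:0, 1:]" d] by (simp add: zpoly_affine pcompose_idR)
    from that show ?thesis
      by (cases rule: gwa_rels_cases)
        (simp_all add: subst_simps z scal_mult_scal scal_simps gwa_rels_mem subst_commutator
          flip: power_add mult_2)
  qed
  show "Omega a \<rho> \<in> ring_iso (cgwa a) (cgwa a)"
    unfolding Omega_def
  proof (rule gwa_map_iso[where t = ?t])
    fix p :: "'a falg" assume p: "p \<in> gwa_rels shift a"
    show "subst ?O p \<in> gwa_ideal shift a" by (rule Omega_rels[OF assms p])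
    have "subst ?t p = subst ?O (subst ?N p)" by (simp add: subst_subst)
    with gwa_ideal_subst[OF Omega_rels[OF assms] N[OF p]]
    show "subst ?t p \<in> gwa_ideal shift a" by simp
  next
    fix g
    show "subst ?O (?t g) = var g" "subst ?t (?O g) = var g"
      by (cases g; simp add: subst_simps c)+
  qed
qed (simp_all add: Omega_def gwa_map_cls Omega_rels[OF assms] subst_simps)

end

theory Submission
  imports Defs
begin

text \<open>
  Let \<open>\<phi> = \<Theta>\<^sub>\<beta> \<circ> \<Omega>\<close>. On the generators it acts by \<open>\<phi> z = 1 + \<rho> - z\<close>, \<open>\<phi> x = \<beta>\<inverse> y\<close>
  and \<open>\<phi> y = (-1)\<^sup>n \<beta> x\<close>, so \<open>\<phi>\<^sup>2\<close> fixes \<open>z\<close> and multiplies \<open>x\<close> and \<open>y\<close> by \<open>(-1)\<^sup>n\<close>. Put \<open>m = 1\<close>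
  if \<open>n\<close> is even and \<open>m = 2\<close> if \<open>n\<close> is odd; then \<open>\<phi>\<^sup>2\<close> fixes \<open>x\<^sup>m\<close>, and \<open>\<phi>\<^sup>4 = 1\<close> in both cases.

  A fixed element \<open>r\<close> equals the average of its four iterates \<open>\<phi>\<^sup>k r\<close>. The algebra is spanned by the
  elements \<open>d x\<^sup>i\<close> and \<open>d y\<^sup>i\<close> with \<open>d\<close> a polynomial in \<open>z\<close> (\<open>gwa_spanned_all\<close>), so the fixed ring
  is spanned by their averages. If \<open>m\<close> does not divide \<open>i\<close>, then \<open>\<phi>\<^sup>2\<close> negates \<open>d x\<^sup>i\<close> and its
  average vanishes. Hence, with the trace \<open>tr r = r + \<phi> r\<close>, the fixed ring is spanned by the elements
  \<open>tr (d x^(m i))\<close>; powers of \<open>y\<close> contribute nothing new because \<open>\<phi>\<close> exchanges \<open>x\<^sup>m\<close> and \<open>y\<^sup>m\<close> up to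
  a scalar.

  It remains to generate these traces from \<open>tr (x\<^sup>m)\<close> and \<open>tr (z x\<^sup>m)\<close>, which are the two listed
  elements. The polynomials in \<open>w = z (1 + \<rho> - z)\<close> are fixed by \<open>\<phi>\<close>, and as a module over \<open>k[w]\<close> the
  ring \<open>k[z]\<close> is generated by \<open>1\<close> and \<open>z\<close> (\<open>poly_split_symmetric\<close>). As \<open>tr\<close> is linear over the fixed
  polynomials, only \<open>tr (x^(m i))\<close> and \<open>tr (z x^(m i))\<close> are needed. These come by induction on \<open>i\<close>
  from the identity \<open>tr r tr s = tr (r s) + tr (r \<phi>(s))\<close>, valid when \<open>\<phi>\<^sup>2 s = s\<close>, with \<open>r\<close> equal to
  \<open>x\<^sup>m\<close> or \<open>z x\<^sup>m\<close> and \<open>s = x^(m i)\<close>: the correction term \<open>r \<phi>(s)\<close> contains a factor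
  \<open>x\<^sup>m y\<^sup>m\<close>, which is a polynomial in \<open>z\<close>, and so has smaller degree (\<open>trace_power_mem\<close>).
\<close>

section \<open>Spanning a generalized Weyl algebra by monomials\<close>

lemma mult_scal_left: "p * (scal c * q) = scal c * (p * q)"
  by (metis mult.assoc scal_comm)

lemma gwa_cls_mult_cong:
  assumes "gwa_cls \<sigma> a p = gwa_cls \<sigma> a q"
  shows "gwa_cls \<sigma> a (r * p * s) = gwa_cls \<sigma> a (r * q * s)"
  using assms by (simp add: gwa_cls_simps)

lemma gwa_cls_rels:
  "gwa_cls \<sigma> a (var Gx * var Gy) = gwa_cls \<sigma> a (zpoly (\<sigma> a))"
  "gwa_cls \<sigma> a (var Gy * var Gx) = gwa_cls \<sigma> a (zpoly a)"
  "gwa_cls \<sigma> a (var Gx * zpoly d) = gwa_cls \<sigma> a (zpoly (\<sigma> d) * var Gx)"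
  "gwa_cls \<sigma> a (var Gy * zpoly d) = gwa_cls \<sigma> a (zpoly (inv_into UNIV \<sigma> d) * var Gy)"
  by (simp_all add: gwa_cls_eq_iff gwa_rels_mem)

lemma gwa_cls_0: "gwa_cls \<sigma> a 0 = \<zero>\<^bsub>gwa \<sigma> a\<^esub>"
  using ring_hom_zero[OF gwa_cls_hom ring_free_alg ring_gwa] by simp

lemma gwa_cls_uminus: "gwa_cls \<sigma> a (- p) = \<ominus>\<^bsub>gwa \<sigma> a\<^esub> gwa_cls \<sigma> a p"
proof -
  interpret ring "gwa \<sigma> a" by (rule ring_gwa)
  have "gwa_cls \<sigma> a (- p) \<oplus>\<^bsub>gwa \<sigma> a\<^esub> gwa_cls \<sigma> a p = \<zero>\<^bsub>gwa \<sigma> a\<^esub>"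
    by (simp add: gwa_cls_0 flip: gwa_cls_simps)
  then show ?thesis
    by (intro minus_equality[symmetric]) (simp_all add: carrier_gwa)
qed

text \<open>
  The predicate lives on the free algebra and is closed under congruence modulo the relations; its
  induction rule reduces a property of all elements of the algebra, stated through
  representatives, to the monomials \<open>d x\<^sup>i\<close> and \<open>d y\<^sup>i\<close>.
\<close>

inductive gwa_spanned ::
    "('k::comm_ring_1 poly \<Rightarrow> 'k poly) \<Rightarrow> 'k poly \<Rightarrow> 'k falg \<Rightarrow> bool" for \<sigma> a where
  x: "gwa_spanned \<sigma> a (zpoly d * var Gx ^ i)"
| y: "gwa_spanned \<sigma> a (zpoly d * var Gy ^ i)"
| add: "gwa_spanned \<sigma> a p \<Longrightarrow> gwa_spanned \<sigma> a q \<Longrightarrow> gwa_spanned \<sigma> a (p + q)"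
| cong: "gwa_spanned \<sigma> a p \<Longrightarrow> gwa_cls \<sigma> a p = gwa_cls \<sigma> a q \<Longrightarrow> gwa_spanned \<sigma> a q"

lemma gwa_spanned_zpoly_mult: "gwa_spanned \<sigma> a p \<Longrightarrow> gwa_spanned \<sigma> a (zpoly e * p)"
proof (induction rule: gwa_spanned.induct)
  case (x d i)
  show ?case using gwa_spanned.x[of \<sigma> a "e * d" i] by (simp add: zpoly_mult mult.assoc)
next
  case (y d i)
  show ?case using gwa_spanned.y[of \<sigma> a "e * d" i] by (simp add: zpoly_mult mult.assoc)
next
  case (add p q)
  then show ?case by (simp add: distrib_left gwa_spanned.add)
next
  case (cong p q)
  from cong(3) show ?case
    by (rule gwa_spanned.cong) (simp add: gwa_cls_simps cong(2))
qed

text \<open>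
  Moving \<open>x\<close> or \<open>y\<close> past the coefficient and, if possible, cancelling it against the opposite
  variable turns the product with a monomial into a monomial again.
\<close>

lemma gwa_spanned_x_mult: "gwa_spanned \<sigma> a p \<Longrightarrow> gwa_spanned \<sigma> a (var Gx * p)"
proof (induction rule: gwa_spanned.induct)
  case (x d i)
  have "gwa_cls \<sigma> a (zpoly (\<sigma> d) * var Gx ^ Suc i) = gwa_cls \<sigma> a (var Gx * (zpoly d * var Gx ^ i))"
    using gwa_cls_mult_cong[OF gwa_cls_rels(3), of \<sigma> a 1 d "var Gx ^ i"] by (simp add: mult.assoc)
  then show ?case by (rule gwa_spanned.cong[OF gwa_spanned.x])
next
  case (y d i)
  have *: "gwa_cls \<sigma> a (zpoly (\<sigma> d) * (var Gx * var Gy ^ i))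
      = gwa_cls \<sigma> a (var Gx * (zpoly d * var Gy ^ i))"
    using gwa_cls_mult_cong[OF gwa_cls_rels(3), of \<sigma> a 1 d "var Gy ^ i"] by (simp add: mult.assoc)
  have "gwa_spanned \<sigma> a (var Gx * var Gy ^ i)"
  proof (cases i)
    case 0
    then show ?thesis using gwa_spanned.x[of \<sigma> a 1 1] by (simp add: zpoly_def scal_simps)
  next
    case (Suc j)
    have "gwa_cls \<sigma> a (zpoly (\<sigma> a) * var Gy ^ j) = gwa_cls \<sigma> a (var Gx * var Gy ^ i)"
      using gwa_cls_mult_cong[OF gwa_cls_rels(1), of \<sigma> a 1 "var Gy ^ j"]
      by (simp add: Suc mult.assoc)
    then show ?thesis by (rule gwa_spanned.cong[OF gwa_spanned.y])
  qed
  then show ?case by (rule gwa_spanned.cong[OF gwa_spanned_zpoly_mult *])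
next
  case (add p q)
  then show ?case by (simp add: distrib_left gwa_spanned.add)
next
  case (cong p q)
  from cong(3) show ?case
    by (rule gwa_spanned.cong) (simp add: gwa_cls_simps cong(2))
qed

lemma gwa_spanned_y_mult: "gwa_spanned \<sigma> a p \<Longrightarrow> gwa_spanned \<sigma> a (var Gy * p)"
proof (induction rule: gwa_spanned.induct)
  case (y d i)
  have "gwa_cls \<sigma> a (zpoly (inv_into UNIV \<sigma> d) * var Gy ^ Suc i)
      = gwa_cls \<sigma> a (var Gy * (zpoly d * var Gy ^ i))"
    using gwa_cls_mult_cong[OF gwa_cls_rels(4), of \<sigma> a 1 d "var Gy ^ i"] by (simp add: mult.assoc)
  then show ?case by (rule gwa_spanned.cong[OF gwa_spanned.y])
next
  case (x d i)
  have *: "gwa_cls \<sigma> a (zpoly (inv_into UNIV \<sigma> d) * (var Gy * var Gx ^ i))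
      = gwa_cls \<sigma> a (var Gy * (zpoly d * var Gx ^ i))"
    using gwa_cls_mult_cong[OF gwa_cls_rels(4), of \<sigma> a 1 d "var Gx ^ i"] by (simp add: mult.assoc)
  have "gwa_spanned \<sigma> a (var Gy * var Gx ^ i)"
  proof (cases i)
    case 0
    then show ?thesis using gwa_spanned.y[of \<sigma> a 1 1] by (simp add: zpoly_def scal_simps)
  next
    case (Suc j)
    have "gwa_cls \<sigma> a (zpoly a * var Gx ^ j) = gwa_cls \<sigma> a (var Gy * var Gx ^ i)"
      using gwa_cls_mult_cong[OF gwa_cls_rels(2), of \<sigma> a 1 "var Gx ^ j"]
      by (simp add: Suc mult.assoc)
    then show ?thesis by (rule gwa_spanned.cong[OF gwa_spanned.x])
  qed
  then show ?case by (rule gwa_spanned.cong[OF gwa_spanned_zpoly_mult *])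
next
  case (add p q)
  then show ?case by (simp add: distrib_left gwa_spanned.add)
next
  case (cong p q)
  from cong(3) show ?case
    by (rule gwa_spanned.cong) (simp add: gwa_cls_simps cong(2))
qed

lemma zpoly_const: "zpoly [:c:] = scal c"
  by (simp add: zpoly_pCons zpoly_0)

lemma gwa_spanned_all:
  fixes p :: "'k::comm_ring_1 falg"
  shows "gwa_spanned \<sigma> a p"
proof (induction p rule: falg_induct)
  case 1
  show ?case using gwa_spanned.x[of \<sigma> a 0 0] by (simp add: zpoly_0)
next
  case (2 w c)
  have "gwa_spanned \<sigma> a (prod_list (map var gs) :: 'k falg)" for gs
  proof (induction gs)
    case Nil
    show ?case using gwa_spanned.x[of \<sigma> a 1 0] by (simp add: zpoly_def scal_simps)
  next
    case (Cons g gs)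
    then show ?case
      using gwa_spanned_zpoly_mult[of \<sigma> a _ "[:0, 1:]"]
      by (cases g) (simp_all add: gwa_spanned_x_mult gwa_spanned_y_mult zpoly_affine)
  qed
  then have "gwa_spanned \<sigma> a (scal c * prod_list (map var (letters w)))"
    using gwa_spanned_zpoly_mult[of \<sigma> a _ "[:c:]"] by (simp add: zpoly_const)
  then show ?case
    using subst_single[of var w c] by (simp add: subst_id)
qed (rule gwa_spanned.add)


section \<open>Polynomials over the symmetric polynomials\<close>

text \<open>
  With \<open>w = z (c - z)\<close> the equation \<open>z\<^sup>2 = c z - w\<close> allows all higher powers of \<open>z\<close> to be reduced.
\<close>

lemma poly_split_symmetric:
  fixes d :: "'k::comm_ring_1 poly"
  obtains p q where
    "d = pcompose p ([:0, 1:] * [:c, -1:]) + [:0, 1:] * pcompose q ([:0, 1:] * [:c, -1:])"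
proof -
  let ?w = "[:0, 1:] * [:c, -1:]"
  have "\<exists>p q. d = pcompose p ?w + [:0, 1:] * pcompose q ?w"
  proof (induction d)
    case 0
    show ?case by (rule exI[of _ 0], rule exI[of _ 0]) simp
  next
    case (pCons k d)
    then obtain p q where d: "d = pcompose p ?w + [:0, 1:] * pcompose q ?w" by blast
    have pcompose_id: "pcompose [:0, 1:] r = r" for r :: "'k poly"
      by (simp add: pcompose_pCons)
    have "[:0, 1:] * [:0, 1:] = smult c [:0, 1:] - ?w" by simp
    then have zz: "[:0, 1:] * ([:0, 1:] * r) = smult c ([:0, 1:] * r) - ?w * r" for r
      by (metis left_diff_distrib mult.assoc mult_smult_left)
    have "pCons k d = [:k:] + [:0, 1:] * d" by simp
    also have "\<dots> = [:k:] - ?w * pcompose q ?w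
        + [:0, 1:] * (pcompose p ?w + smult c (pcompose q ?w))"
      unfolding d distrib_left zz mult_smult_right by (simp only: algebra_simps)
    also have "\<dots> = pcompose ([:k:] - [:0, 1:] * q) ?w + [:0, 1:] * pcompose (p + smult c q) ?w"
      by (simp add: pcompose_diff pcompose_add pcompose_smult pcompose_mult pcompose_id
          del: mult_pCons_left mult_pCons_right)
    finally show ?case by blast
  qed
  then show ?thesis using that by blast
qed


section \<open>The automorphism and its trace\<close>

locale reflective_gwa =
  fixes a :: "'k::field_char_0 poly" and \<rho> \<beta> :: 'k
  assumes reflective: "pcompose a [:\<rho>, -1:] = (-1) ^ degree a * a"
    and beta: "\<beta> \<noteq> 0"
begin

abbreviation cls :: "'k falg \<Rightarrow> 'k falg set" where "cls \<equiv> cgwa_cls a"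

text \<open>
  The lift of the automorphism to the free algebra, where computations can use type class algebra.
\<close>

definition \<phi> :: "'k falg \<Rightarrow> 'k falg"
  where "\<phi> p = subst (Theta_gen \<beta>) (subst (Omega_gen (degree a) \<rho>) p)"

lemma \<phi>_simps:
  "\<phi> (p + q) = \<phi> p + \<phi> q" "\<phi> (p * q) = \<phi> p * \<phi> q" "\<phi> (- p) = - \<phi> p" "\<phi> (p - q) = \<phi> p - \<phi> q"
  "\<phi> 0 = 0" "\<phi> 1 = 1" "\<phi> (scal c) = scal c"
  by (simp_all add: \<phi>_def subst_simps)

lemma \<phi>_var:
  "\<phi> (var Gz) = scal (1 + \<rho>) - var Gz"
  "\<phi> (var Gx) = scal (inverse \<beta>) * var Gy"
  "\<phi> (var Gy) = scal ((-1) ^ degree a * \<beta>) * var Gx"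
  by (simp_all add: \<phi>_def subst_simps scal_simps mult.assoc)

lemma \<phi>_power: "\<phi> (p ^ i) = \<phi> p ^ i"
  by (induction i) (simp_all add: \<phi>_simps)

lemma \<phi>_zpoly: "\<phi> (zpoly d) = zpoly (pcompose d [:1 + \<rho>, -1:])"
  using subst_zpoly[of "Omega_gen (degree a) \<rho>" "[:1 + \<rho>, -1:]" d]
    subst_zpoly[of "Theta_gen \<beta>" "[:0, 1:]" "pcompose d [:1 + \<rho>, -1:]"]
  by (simp add: \<phi>_def zpoly_affine pcompose_idR)

lemma scal_mult_power: "(scal c * p) ^ i = scal (c ^ i) * p ^ i" for c :: 'k
  by (induction i) (simp_all add: scal_simps scal_mult_scal)

lemma \<phi>_x_power: "\<phi> (var Gx ^ i) = scal (inverse \<beta> ^ i) * var Gy ^ i"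
  by (simp add: \<phi>_power \<phi>_var scal_mult_power)

lemma pcompose_flip_flip: "pcompose (pcompose d [:1 + \<rho>, -1:]) [:1 + \<rho>, -1:] = d"
  by (simp add: pcompose_pCons pcompose_idR flip: pcompose_assoc)

lemma \<phi>_\<phi>_zpoly: "\<phi> (\<phi> (zpoly d)) = zpoly d"
  by (simp add: \<phi>_zpoly pcompose_flip_flip)

lemma \<phi>_\<phi>_var:
  "\<phi> (\<phi> (var Gx)) = scal ((-1) ^ degree a) * var Gx"
  "\<phi> (\<phi> (var Gy)) = scal ((-1) ^ degree a) * var Gy"
proof -
  have scalars: "inverse \<beta> * (-1) ^ degree a * \<beta> = (-1) ^ degree a"
    "(-1) ^ degree a * \<beta> * inverse \<beta> = (-1) ^ degree a"
    using beta by simp_all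
  then show "\<phi> (\<phi> (var Gx)) = scal ((-1) ^ degree a) * var Gx"
    "\<phi> (\<phi> (var Gy)) = scal ((-1) ^ degree a) * var Gy"
    by (simp_all add: \<phi>_var \<phi>_simps scalars flip: mult.assoc scal_simps(2))
qed

lemma \<phi>_\<phi>_monomial:
  assumes "g \<in> {Gx, Gy}"
  shows "\<phi> (\<phi> (zpoly d * var g ^ i)) = scal ((-1) ^ (degree a * i)) * (zpoly d * var g ^ i)"
proof -
  have "\<phi> (\<phi> (zpoly d * var g ^ i)) = zpoly d * (scal ((-1) ^ (degree a * i)) * var g ^ i)"
    using assms by (auto simp: \<phi>_simps \<phi>_power \<phi>_\<phi>_zpoly \<phi>_\<phi>_var scal_mult_power simp flip: power_mult)
  then show ?thesis by (simp only: mult_scal_left)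
qed

lemma automorphism_cls: "(Theta a \<beta> \<circ> Omega a \<rho>) (cls p) = cls (\<phi> p)"
  by (simp add: Theta_def Omega_def gwa_map_cls Theta_rels Omega_rels reflective beta \<phi>_def)

lemma \<phi>_cong: "cls p = cls q \<Longrightarrow> cls (\<phi> p) = cls (\<phi> q)"
  by (metis automorphism_cls)

lemma cls_in_fixed_iff: "cls p \<in> fixed_elems (cgwa a) (Theta a \<beta> \<circ> Omega a \<rho>) \<longleftrightarrow> cls (\<phi> p) = cls p"
  unfolding fixed_elems_def using automorphism_cls[of p] by (auto simp: carrier_gwa)

lemma subring_fixed: "subring (fixed_elems (cgwa a) (Theta a \<beta> \<circ> Omega a \<rho>)) (cgwa a)"
proof (rule ring.subringI[OF ring_gwa])
  let ?F = "fixed_elems (cgwa a) (Theta a \<beta> \<circ> Omega a \<rho>)"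
  have rep: "\<exists>p. h = cls p \<and> cls (\<phi> p) = cls p" if "h \<in> ?F" for h
    using that cls_in_fixed_iff by (auto simp: fixed_elems_def carrier_gwa)
  show "?F \<subseteq> carrier (cgwa a)" by (auto simp: fixed_elems_def)
  show "\<one>\<^bsub>cgwa a\<^esub> \<in> ?F"
    using cls_in_fixed_iff[of 1] by (simp add: \<phi>_simps gwa_cls_simps)
  show "\<ominus>\<^bsub>cgwa a\<^esub> h \<in> ?F" if "h \<in> ?F" for h
  proof -
    from rep[OF that] obtain p where "h = cls p" "cls (\<phi> p) = cls p" by blast
    then show ?thesis using cls_in_fixed_iff[of "- p"] by (simp add: \<phi>_simps gwa_cls_uminus)
  qed
  show "h1 \<otimes>\<^bsub>cgwa a\<^esub> h2 \<in> ?F" if "h1 \<in> ?F" "h2 \<in> ?F" for h1 h2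
  proof -
    from rep[OF that(1)] rep[OF that(2)] obtain p q where
      "h1 = cls p" "cls (\<phi> p) = cls p" "h2 = cls q" "cls (\<phi> q) = cls q" by blast
    then show ?thesis using cls_in_fixed_iff[of "p * q"] by (simp add: \<phi>_simps gwa_cls_simps)
  qed
  show "h1 \<oplus>\<^bsub>cgwa a\<^esub> h2 \<in> ?F" if "h1 \<in> ?F" "h2 \<in> ?F" for h1 h2
  proof -
    from rep[OF that(1)] rep[OF that(2)] obtain p q where
      "h1 = cls p" "cls (\<phi> p) = cls p" "h2 = cls q" "cls (\<phi> q) = cls q" by blast
    then show ?thesis using cls_in_fixed_iff[of "p + q"] by (simp add: \<phi>_simps gwa_cls_simps)
  qed
qed

definition tr :: "'k falg \<Rightarrow> 'k falg" where "tr p = p + \<phi> p"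

lemma tr_add: "tr (p + q) = tr p + tr q"
  by (simp add: tr_def \<phi>_simps algebra_simps)

lemma tr_cong: "cls p = cls q \<Longrightarrow> cls (tr p) = cls (tr q)"
  using \<phi>_cong[of p q] by (simp add: tr_def gwa_cls_simps)

lemma tr_\<phi>: "\<phi> (\<phi> p) = p \<Longrightarrow> tr (\<phi> p) = tr p"
  by (simp add: tr_def add.commute)

lemma tr_fixed_mult: "\<phi> c = c \<Longrightarrow> tr (c * p) = c * tr p"
  by (simp add: tr_def \<phi>_simps distrib_left)

text \<open>
  This identity drives the generation argument: it trades the trace of a product for a product of
  traces and a correction in which \<open>x\<close> meets \<open>y\<close>.
\<close>

lemma tr_mult_tr: "\<phi> (\<phi> s) = s \<Longrightarrow> tr r * tr s = tr (r * s) + tr (r * \<phi> s)"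
  by (simp add: tr_def \<phi>_simps algebra_simps)

lemma fixed_cls_tr:
  assumes "\<phi> (\<phi> p) = p"
  shows "cls (tr p) \<in> fixed_elems (cgwa a) (Theta a \<beta> \<circ> Omega a \<rho>)"
  unfolding cls_in_fixed_iff using assms by (simp add: tr_def \<phi>_simps add.commute)

lemma \<phi>_symmetric:
  "\<phi> (zpoly (pcompose d ([:0, 1:] * [:1 + \<rho>, -1:]))) = zpoly (pcompose d ([:0, 1:] * [:1 + \<rho>, -1:]))"
proof -
  have "pcompose ([:0, 1:] * [:1 + \<rho>, -1:]) [:1 + \<rho>, -1:] = [:0, 1:] * [:1 + \<rho>, -1:]"
    by (simp add: pcompose_pCons algebra_simps)
  then show ?thesis
    by (simp only: \<phi>_zpoly flip: pcompose_assoc)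
qed


section \<open>Generating the traces\<close>

text \<open>
  The exponent of the smallest positive power of \<open>x\<close> fixed by \<open>\<phi>\<^sup>2\<close>.
\<close>

definition m :: nat where "m = (if even (degree a) then 1 else 2)"

lemma sign_power_m: "(-1 :: 'k) ^ (degree a * (m * i)) = 1"
proof -
  have "even (degree a * (m * i))" by (simp add: m_def)
  then show ?thesis by (rule neg_one_even_power)
qed

lemma \<phi>_\<phi>_x_power: "\<phi> (\<phi> (zpoly d * var Gx ^ (m * i))) = zpoly d * var Gx ^ (m * i)"
  by (simp add: \<phi>_\<phi>_monomial sign_power_m scal_simps)

text \<open>
  For \<open>m = 2\<close> the inner factor \<open>x y\<close> of \<open>x x y y\<close> is a polynomial in \<open>z\<close>, past which the outer \<open>x\<close>
  can be moved to meet the outer \<open>y\<close>.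
\<close>

lemma xm_ym_is_zpoly: "\<exists>b. cls (var Gx ^ m * var Gy ^ m) = cls (zpoly b)"
proof (cases "even (degree a)")
  case True
  then show ?thesis using gwa_cls_rels(1)[of shift a] by (auto simp: m_def)
next
  case False
  have "cls (var Gx ^ m * var Gy ^ m) = cls (var Gx * (var Gx * var Gy) * var Gy)"
    using False by (simp add: m_def power2_eq_square mult.assoc)
  also have "\<dots> = cls (var Gx * zpoly (shift a) * var Gy)"
    by (rule gwa_cls_mult_cong) (rule gwa_cls_rels)
  also have "\<dots> = cls (zpoly (shift (shift a)) * (var Gx * var Gy))"
    using gwa_cls_mult_cong[OF gwa_cls_rels(3), of shift a 1 "shift a" "var Gy"]
    by (simp add: mult.assoc)
  also have "\<dots> = cls (zpoly (shift (shift a) * shift a))"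
    by (simp add: gwa_cls_simps gwa_cls_rels(1)[unfolded gwa_cls_simps] zpoly_mult)
  finally show ?thesis by blast
qed

context
  fixes K :: "'k falg set set"
  assumes K: "subring K (cgwa a)"
    and symm: "sym_subalg a \<rho> \<subseteq> K"
    and xm: "cls (tr (var Gx ^ m)) \<in> K"
    and zxm: "cls (tr (var Gz * var Gx ^ m)) \<in> K"
begin

lemma mem_add: "cls p \<in> K \<Longrightarrow> cls q \<in> K \<Longrightarrow> cls (p + q) \<in> K"
  using subringE(7)[OF K] by (simp add: gwa_cls_simps)

lemma mem_mult: "cls p \<in> K \<Longrightarrow> cls q \<in> K \<Longrightarrow> cls (p * q) \<in> K"
  using subringE(6)[OF K] by (simp add: gwa_cls_simps)

lemma mem_uminus: "cls p \<in> K \<Longrightarrow> cls (- p) \<in> K"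
  using subringE(5)[OF K] by (simp add: gwa_cls_uminus)

lemma mem_diff: "cls p \<in> K \<Longrightarrow> cls q \<in> K \<Longrightarrow> cls (p - q) \<in> K"
  using mem_add[of p "- q"] mem_uminus[of q] by simp

lemma mem_symmetric: "cls (zpoly (pcompose d ([:0, 1:] * [:1 + \<rho>, -1:]))) \<in> K"
  using symm by (auto simp: sym_subalg_def)

lemma mem_scal: "cls (scal c) \<in> K"
  using mem_symmetric[of "[:c:]"] by (simp add: zpoly_const)

lemma trace_split_mem:
  assumes "cls (tr u) \<in> K" "cls (tr (var Gz * u)) \<in> K"
  shows "cls (tr (zpoly d * u)) \<in> K"
proof -
  let ?w = "[:0, 1:] * [:1 + \<rho>, -1:]"
  obtain p q where d: "d = pcompose p ?w + [:0, 1:] * pcompose q ?w"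
    by (rule poly_split_symmetric)
  have "zpoly d * u = zpoly (pcompose p ?w) * u + zpoly (pcompose q ?w) * (var Gz * u)"
    unfolding d mult.commute[of "[:0, 1:]" "pcompose q ?w"]
    by (simp only: zpoly_add zpoly_mult zpoly_affine distrib_right mult.assoc)
  then have "tr (zpoly d * u)
      = zpoly (pcompose p ?w) * tr u + zpoly (pcompose q ?w) * tr (var Gz * u)"
    by (simp only: tr_add tr_fixed_mult[OF \<phi>_symmetric])
  then show ?thesis
    using assms by (simp only: mem_add mem_mult mem_symmetric)
qed

text \<open>
  Up to a scalar, \<open>d y^(m i)\<close> is the image under \<open>\<phi>\<close> of \<open>e x^(m i)\<close> with \<open>e(z) = d(1 + \<rho> - z)\<close>, and
  an element fixed by \<open>\<phi>\<^sup>2\<close> has the same trace as its image.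
\<close>

lemma trace_y_power_mem:
  assumes "\<And>d. cls (tr (zpoly d * var Gx ^ (m * i))) \<in> K"
  shows "cls (tr (zpoly d * var Gy ^ (m * i))) \<in> K"
proof -
  let ?p = "zpoly (pcompose d [:1 + \<rho>, -1:]) * var Gx ^ (m * i)"
  have "scal (\<beta> ^ (m * i)) * \<phi> ?p
      = scal (\<beta> ^ (m * i)) * zpoly d * (scal (inverse \<beta> ^ (m * i)) * var Gy ^ (m * i))"
    by (simp add: \<phi>_simps \<phi>_zpoly pcompose_flip_flip \<phi>_x_power mult.assoc)
  also have "\<dots> = scal (\<beta> ^ (m * i) * inverse \<beta> ^ (m * i)) * (zpoly d * var Gy ^ (m * i))"
    by (rule scal_mult_scal)
  also have "\<beta> ^ (m * i) * inverse \<beta> ^ (m * i) = 1"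
    using beta by (simp flip: power_mult_distrib)
  finally have "zpoly d * var Gy ^ (m * i) = scal (\<beta> ^ (m * i)) * \<phi> ?p"
    by (simp add: scal_simps)
  then have "tr (zpoly d * var Gy ^ (m * i)) = scal (\<beta> ^ (m * i)) * tr ?p"
    by (simp add: tr_fixed_mult \<phi>_simps(7) tr_\<phi> \<phi>_\<phi>_x_power)
  then show ?thesis using assms by (simp add: mem_mult mem_scal)
qed

text \<open>
  For \<open>r\<close> either \<open>x\<^sup>m\<close> or \<open>z x\<^sup>m\<close>, the identity \<open>tr r tr s = tr (r s) + tr (r \<phi>(s))\<close> with
  \<open>s = x^(m (j + 1))\<close> expresses the traces of degree \<open>m (j + 2)\<close> through known ones: \<open>\<phi>(s)\<close> is a
  multiple of \<open>y^(m (j + 1))\<close>, one factor \<open>y\<^sup>m\<close> of which cancels against \<open>x\<^sup>m\<close>, and the traces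
  of the resulting elements \<open>e y^(m j)\<close> are known by \<open>trace_y_power_mem\<close>.
\<close>

lemma trace_power_mem: "cls (tr (zpoly d * var Gx ^ (m * i))) \<in> K"
proof (induction i arbitrary: d rule: less_induct)
  case (less i)
  consider "i = 0" | "i = 1" | j where "i = Suc (Suc j)"
    by (metis One_nat_def not0_implies_Suc)
  then show ?case
  proof cases
    case 1
    have "tr 1 = scal 2" "tr (var Gz) = scal (1 + \<rho>)"
      using scal_simps(1)[of 1 "1::'k"] by (simp_all add: tr_def \<phi>_simps \<phi>_var scal_simps(4))
    with 1 show ?thesis
      using trace_split_mem[of 1 d] by (simp add: mem_scal)
  next
    case 2
    then show ?thesis using trace_split_mem[OF xm zxm] by simp
  next
    case (3 j)
    obtain b where b: "cls (var Gx ^ m * var Gy ^ m) = cls (zpoly b)"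
      using xm_ym_is_zpoly by blast
    let ?s = "var Gx ^ (m * Suc j)"
    have s: "\<phi> (\<phi> ?s) = ?s"
      using \<phi>_\<phi>_x_power[of 1 "Suc j"] by (simp only: zpoly_const one_pCons scal_simps mult_1_left)
    have tr_s: "cls (tr ?s) \<in> K"
      using less.IH[of "Suc j" 1] 3 by (simp only: zpoly_const one_pCons scal_simps mult_1_left lessI)
    have y: "cls (tr (zpoly e * var Gy ^ (m * j))) \<in> K" for e
      using less.IH[of j] 3 by (intro trace_y_power_mem) simp
    have step: "cls (tr (zpoly e * var Gx ^ m * ?s)) \<in> K"
      if r: "cls (tr (zpoly e * var Gx ^ m)) \<in> K" for e
    proof -
      let ?c = "inverse \<beta> ^ (m * Suc j)"
      let ?r = "zpoly e * var Gx ^ m"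
      have "?r * \<phi> ?s = ?r * (scal ?c * var Gy ^ (m * Suc j))"
        by (simp only: \<phi>_x_power)
      also have "\<dots> = scal ?c * zpoly e * (var Gx ^ m * var Gy ^ m) * var Gy ^ (m * j)"
        by (simp only: mult_scal_left mult_Suc_right power_add mult.assoc)
      also have "cls \<dots> = cls (scal ?c * zpoly e * zpoly b * var Gy ^ (m * j))"
        by (rule gwa_cls_mult_cong[OF b])
      also have "scal ?c * zpoly e * zpoly b = zpoly (smult ?c (e * b))"
        by (simp add: zpoly_smult zpoly_mult mult.assoc)
      finally have "cls (tr (?r * \<phi> ?s)) \<in> K"
        using y tr_cong by metis
      moreover have "cls (tr ?r * tr ?s) \<in> K"
        using r tr_s by (rule mem_mult)
      moreover have "tr (?r * ?s) = tr ?r * tr ?s - tr (?r * \<phi> ?s)"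
        by (simp only: tr_mult_tr[OF s] add_diff_cancel_right')
      ultimately show ?thesis by (simp add: mem_diff)
    qed
    have pow: "var Gx ^ (m * i) = var Gx ^ m * ?s"
      by (simp add: 3 power_add)
    have "cls (tr (var Gx ^ (m * i))) \<in> K"
      using step[of 1] xm by (simp add: pow zpoly_const one_pCons scal_simps)
    moreover have "cls (tr (var Gz * var Gx ^ (m * i))) \<in> K"
      using step[of "[:0, 1:]"] zxm by (simp add: pow zpoly_affine mult.assoc)
    ultimately show ?thesis by (rule trace_split_mem)
  qed
qed

text \<open>
  The argument of \<open>cls\<close> is \<open>p + \<phi> p + \<phi>\<^sup>2 p + \<phi>\<^sup>3 p\<close>, grouped so that the orders two and four are
  covered together: on a monomial in \<open>x\<close> or \<open>y\<close> whose degree is a multiple of \<open>m\<close> the inner sum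
  doubles, and on the other monomials it vanishes because \<open>\<phi>\<^sup>2\<close> changes the sign.
\<close>

lemma orbit_sum_mem: "cls (tr (p + \<phi> (\<phi> p))) \<in> K"
proof -
  have monomial: "cls (tr (zpoly d * var g ^ i + \<phi> (\<phi> (zpoly d * var g ^ i)))) \<in> K"
    if g: "g \<in> {Gx, Gy}" and mem: "\<And>d j. cls (tr (zpoly d * var g ^ (m * j))) \<in> K" for g d i
  proof (cases "m dvd i")
    case True
    then obtain j where "i = m * j" by blast
    then show ?thesis
      using mem[of d j] by (simp add: \<phi>_\<phi>_monomial[OF g] sign_power_m scal_simps tr_add mem_add)
  next
    case False
    then have "odd (degree a * i)" by (auto simp: m_def split: if_splits)
    then have "(-1 :: 'k) ^ (degree a * i) = -1" by (rule neg_one_odd_power)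
    then have "zpoly d * var g ^ i + \<phi> (\<phi> (zpoly d * var g ^ i)) = 0"
      by (simp add: \<phi>_\<phi>_monomial[OF g] scal_simps)
    then show ?thesis
      using mem_scal[of 0] by (simp add: scal_simps tr_def \<phi>_simps(5))
  qed
  show ?thesis
    using gwa_spanned_all[of shift a p]
  proof (induction rule: gwa_spanned.induct)
    case (x d i)
    show ?case using monomial[of Gx d i] trace_power_mem by simp
  next
    case (y d i)
    show ?case using monomial[of Gy d i] trace_y_power_mem[OF trace_power_mem] by simp
  next
    case (add p q)
    have "p + q + \<phi> (\<phi> (p + q)) = (p + \<phi> (\<phi> p)) + (q + \<phi> (\<phi> q))"
      by (simp add: \<phi>_simps)
    then show ?case using add by (simp only: tr_add mem_add)
  next
    case (cong p q)
    have "cls (tr (p + \<phi> (\<phi> p))) = cls (tr (q + \<phi> (\<phi> q)))"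
      using tr_cong cong(2) \<phi>_cong[OF \<phi>_cong[OF cong(2)]] by (simp add: gwa_cls_simps)
    with cong show ?case by simp
  qed
qed

text \<open>
  The orbit sum of a fixed element is four times that element, and four is invertible.
\<close>

lemma fixed_mem:
  assumes "r \<in> fixed_elems (cgwa a) (Theta a \<beta> \<circ> Omega a \<rho>)"
  shows "r \<in> K"
proof -
  from assms obtain p where r: "r = cls p" "cls (\<phi> p) = cls p"
    using cls_in_fixed_iff by (auto simp: fixed_elems_def carrier_gwa)
  have "cls (tr (p + \<phi> (\<phi> p))) = cls ((p + p) + (p + p))"
    using r(2) \<phi>_cong[OF r(2)] \<phi>_cong[OF \<phi>_cong[OF r(2)]]
    by (simp add: tr_def \<phi>_simps gwa_cls_simps)
  also have "(p + p) + (p + p) = scal 4 * p"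
  proof -
    have "(4 :: 'k) = 1 + 1 + (1 + 1)" by simp
    then show ?thesis by (simp only: scal_simps distrib_right mult_1_left)
  qed
  finally have "cls (scal 4 * p) \<in> K" using orbit_sum_mem[of p] by simp
  then have "cls (scal (1/4) * (scal 4 * p)) \<in> K" by (rule mem_mult[OF mem_scal])
  moreover have "scal (1/4) * (scal 4 * p) = p"
    by (simp add: scal_simps(4) flip: mult.assoc scal_simps(2))
  ultimately show ?thesis by (simp add: r(1))
qed

end

text \<open>
  The fixed ring is the least subring containing the listed elements, since the generation argument
  applies to every such subring.
\<close>

theorem fixed_ring_generated_by_traces:
  "fixed_elems (cgwa a) (Theta a \<beta> \<circ> Omega a \<rho>) = generate_ring (cgwa a)
    (sym_subalg a \<rho> \<union> {cls (tr (var Gx ^ m)), cls (tr (var Gz * var Gx ^ m))})"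
proof (rule ring.generate_ringI[OF ring_gwa])
  let ?G = "sym_subalg a \<rho> \<union> {cls (tr (var Gx ^ m)), cls (tr (var Gz * var Gx ^ m))}"
  let ?F = "fixed_elems (cgwa a) (Theta a \<beta> \<circ> Omega a \<rho>)"
  show "subring ?F (cgwa a)" by (rule subring_fixed)
  have "sym_subalg a \<rho> \<subseteq> ?F"
    unfolding sym_subalg_def image_subset_iff
    by (intro ballI) (simp only: cls_in_fixed_iff \<phi>_symmetric)
  moreover have "cls (tr (var Gx ^ m)) \<in> ?F" "cls (tr (var Gz * var Gx ^ m)) \<in> ?F"
    using \<phi>_\<phi>_x_power[of 1 1] \<phi>_\<phi>_x_power[of "[:0, 1:]" 1]
    by (simp_all add: fixed_cls_tr zpoly_affine zpoly_const one_pCons scal_simps)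
  ultimately show sub: "?G \<subseteq> ?F" by blast
  show "?G \<subseteq> carrier (cgwa a)" using sub by (auto simp: fixed_elems_def)
  show "?F \<subseteq> K" if "subring K (cgwa a)" "?G \<subseteq> K" for K
    using fixed_mem[OF that(1)] that(2) by auto
qed

end


section \<open>The fixed rings\<close>

theorem theorem3p2:
  fixes a :: "'k::{alg_closed_field, field_char_0} poly"
    and \<rho> \<beta> :: 'k
    and n :: nat
  assumes monic: "lead_coeff a = 1"
    and root: "poly a 0 = 0"
    and n: "n = degree a"
    and reflective: "pcompose a [:\<rho>, -1:] = (-1) ^ n * a"
    and beta: "\<beta> \<noteq> 0"
  shows
    "(even n \<longrightarrow>
       fixed_elems (cgwa a) (Theta a \<beta> \<circ> Omega a \<rho>) =
       generate_ring (cgwa a)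
         (sym_subalg a \<rho> \<union>
          {cgwa_cls a (var Gx + scal (inverse \<beta>) * var Gy),
           cgwa_cls a (var Gz * var Gx
             + scal (inverse \<beta>) * (scal (1 + \<rho>) - var Gz) * var Gy)}))
     \<and>
     (odd n \<longrightarrow>
       fixed_elems (cgwa a) (Theta a \<beta> \<circ> Omega a \<rho>) =
       generate_ring (cgwa a)
         (sym_subalg a \<rho> \<union>
          {cgwa_cls a (var Gx ^ 2 + scal (inverse (\<beta> ^ 2)) * var Gy ^ 2),
           cgwa_cls a (var Gz * var Gx ^ 2
             + scal (inverse (\<beta> ^ 2)) * (scal (1 + \<rho>) - var Gz) * var Gy ^ 2)}))"
proof -
  interpret reflective_gwa a \<rho> \<beta>
    using reflective beta by unfold_locales (simp_all add: n)
  have g1: "tr (var Gx ^ m) = var Gx ^ m + scal (inverse (\<beta> ^ m)) * var Gy ^ m"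
    by (simp add: tr_def \<phi>_x_power power_inverse)
  have g2: "tr (var Gz * var Gx ^ m)
      = var Gz * var Gx ^ m + scal (inverse (\<beta> ^ m)) * (scal (1 + \<rho>) - var Gz) * var Gy ^ m"
    by (simp add: tr_def \<phi>_simps \<phi>_x_power \<phi>_var(1) power_inverse mult_scal_left mult.assoc)
  show ?thesis
  proof (intro conjI impI)
    assume "even n"
    then have "m = 1" by (simp add: m_def n)
    then show "fixed_elems (cgwa a) (Theta a \<beta> \<circ> Omega a \<rho>) =
       generate_ring (cgwa a)
         (sym_subalg a \<rho> \<union>
          {cgwa_cls a (var Gx + scal (inverse \<beta>) * var Gy),
           cgwa_cls a (var Gz * var Gx
             + scal (inverse \<beta>) * (scal (1 + \<rho>) - var Gz) * var Gy)})"
      using fixed_ring_generated_by_traces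
      unfolding g1 g2 by (simp only: power_one_right)
  next
    assume "odd n"
    then have "m = 2" by (simp add: m_def n)
    then show "fixed_elems (cgwa a) (Theta a \<beta> \<circ> Omega a \<rho>) =
       generate_ring (cgwa a)
         (sym_subalg a \<rho> \<union>
          {cgwa_cls a (var Gx ^ 2 + scal (inverse (\<beta> ^ 2)) * var Gy ^ 2),
           cgwa_cls a (var Gz * var Gx ^ 2
             + scal (inverse (\<beta> ^ 2)) * (scal (1 + \<rho>) - var Gz) * var Gy ^ 2)})"
      using fixed_ring_generated_by_traces
      unfolding g1 g2 by (simp only: power_one_right)
  qed
qed

end
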